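(* Let $w$ be a non-negative real-valued function of bounded variation on $[0,1]$ and let $x \in (0,1)$ be fixed. Assume that at least one of the left limit $w(x-)$ and the right limit $w(x+)$ of $w$ at $x$ is non-zero. Then for every real-valued function $f$ of bounded variation on $[0,1]$, $$\lim_{n \to \infty} M_{n,w}(f)(x) = (1-\nu) f(x-) + \nu f(x+),$$ where $$\nu = \int_0^1 \frac{w(x+)(1-u)}{w(x-)u + w(x+)(1-u)}\, du.$$
   Context: For integers $0 \le k \le n$ and $t \in [0,1]$, let $p_{n,k}(t) = \binom{n}{k} t^k (1-t)^{n-k}$. The Bernstein-Durrmeyer operator with non-negative weight $w$ is $$M_{n,w}(f)(x) = \sum_{k=0}^n p_{n,k}(x)\,\frac{\int_0^1 f(t)\,p_{n,k}(t)\,w(t)\,dt}{\int_0^1 p_{n,k}(t)\,w(t)\,dt}, \qquad x \in [0,1],$$ for functions $f$ on $[0,1]$ integrable with respect to $w(t)\,dt$. For a function $g$, $g(x-)$ and $g(x+)$ denote its left and right limits at $x$. *)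

theory Defs
  imports "HOL-Analysis.Analysis"
begin

text \<open>
  Functions on \<open>[0,1]\<close> are rendered as functions on all reals whose values outside \<open>[0,1]\<close>
  are irrelevant.
\<close>

definition bounded_variation_on :: "(real \<Rightarrow> real) \<Rightarrow> real \<Rightarrow> real \<Rightarrow> bool" where
  "bounded_variation_on f a b \<longleftrightarrow>
     (\<exists>B. \<forall>(N::nat) p. p 0 = a \<and> p N = b \<and> (\<forall>i<N. p i < p (Suc i)) \<longrightarrow>
        (\<Sum>i<N. \<bar>f (p (Suc i)) - f (p i)\<bar>) \<le> B)"

text \<open>
  The one-sided limits are meaningful only where they exist, as they do at interior points for
  functions of bounded variation.
\<close>

definition left_limit :: "(real \<Rightarrow> real) \<Rightarrow> real \<Rightarrow> real" where
  "left_limit g x = Lim (at_left x) g"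

definition right_limit :: "(real \<Rightarrow> real) \<Rightarrow> real \<Rightarrow> real" where
  "right_limit g x = Lim (at_right x) g"

text \<open>The library's \<^term>\<open>Bernstein n k\<close> is the polynomial \<open>p\<^sub>n\<^sub>,\<^sub>k\<close>.\<close>

definition bernstein_durrmeyer ::
    "nat \<Rightarrow> (real \<Rightarrow> real) \<Rightarrow> (real \<Rightarrow> real) \<Rightarrow> real \<Rightarrow> real" where
  "bernstein_durrmeyer n w f x =
     (\<Sum>k=0..n. Bernstein n k x *
        ((LINT t:{0..1}|lborel. f t * Bernstein n k t * w t) /
         (LINT t:{0..1}|lborel. Bernstein n k t * w t)))"

text \<open>
  If one of the two limits vanishes, the integrand takes the value \<open>0 / 0 = 0\<close> at one endpoint,
  which does not affect the integral.
\<close>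

definition durrmeyer_nu :: "(real \<Rightarrow> real) \<Rightarrow> real \<Rightarrow> real" where
  "durrmeyer_nu w x =
     (LINT u:{0..1}|lborel.
        right_limit w x * (1 - u) / (left_limit w x * u + right_limit w x * (1 - u)))"

end

theory Submission
  imports Defs "HOL-Real_Asymp.Real_Asymp"
begin

text \<open>
  For the step weight \<open>w\<^sub>0 = a\<close> on the left of \<open>x\<close> and \<open>b\<close> on the right, put
  \<open>U\<^sub>k = (n + 1) \<integral>\<^sub>0\<^sup>x p\<^sub>n\<^sub>,\<^sub>k\<close>. The normalised mass that \<open>p\<^sub>n\<^sub>,\<^sub>k w\<^sub>0\<close> puts on the right of \<open>x\<close> is
  \<open>h(U\<^sub>k)\<close> with \<open>h(u) = b(1 - u) / (au + b(1 - u))\<close>. Now \<open>U\<^sub>k\<close> is a tail of the binomial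
  distribution with parameters \<open>n + 1\<close> and \<open>x\<close>, and it lies between two consecutive tails
  of the distribution with parameters \<open>n\<close> and \<open>x\<close>, whose difference is \<open>p\<^sub>n\<^sub>,\<^sub>k(x)\<close>. So
  \<open>\<Sum>\<^sub>k p\<^sub>n\<^sub>,\<^sub>k(x) h(U\<^sub>k)\<close> is a tagged Riemann sum of the monotone function \<open>h\<close> on \<open>[0,1]\<close>; its mesh
  is \<open>O(n\<^bsup>-1/2\<^esup>)\<close>, and its limit is \<open>\<nu>\<close>.

  Replacing \<open>w\<close> and \<open>f\<close> by the step functions with the same one-sided limits at \<open>x\<close> costs little:
  the error \<open>\<psi>\<close> vanishes at \<open>x\<close>, so its unweighted Durrmeyer mean tends to \<open>0\<close> by the second
  moment, and the indices with a small denominator \<open>a U\<^sub>k + b(1 - U\<^sub>k)\<close> carry little mass, again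
  by the Riemann sum argument.
\<close>

section \<open>Bernstein polynomials and binomial tails\<close>

lemma Bernstein_eq_0 [simp]: "n < k \<Longrightarrow> Bernstein n k x = 0"
  by (simp add: Bernstein_def)

lemma Bernstein_Suc_Suc:
  "Bernstein (Suc n) (Suc k) x = x * Bernstein n k x + (1 - x) * Bernstein n (Suc k) x"
proof (cases "k < n")
  case True
  then have "n - k = Suc (n - Suc k)" by simp
  then show ?thesis by (simp add: Bernstein_def algebra_simps)
next
  case False
  then show ?thesis by (simp add: Bernstein_def binomial_eq_0)
qed

lemma mult_x_Bernstein:
  "real (Suc n) * (x * Bernstein n k x) = real (Suc k) * Bernstein (Suc n) (Suc k) x"
proof -
  have "real (Suc k) * real (Suc n choose Suc k) = real (Suc n) * real (n choose k)"
    by (metis Suc_times_binomial of_nat_mult)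
  moreover have "real (Suc k) * Bernstein (Suc n) (Suc k) x
      = (real (Suc k) * real (Suc n choose Suc k)) * (x * x ^ k * (1 - x) ^ (n - k))"
    by (simp add: Bernstein_def del: of_nat_Suc binomial_Suc_Suc)
  ultimately show ?thesis
    by (simp add: Bernstein_def del: of_nat_Suc binomial_Suc_Suc)
qed

lemma mult_one_minus_x_Bernstein:
  "real (Suc n) * ((1 - x) * Bernstein n k x) = (real (Suc n) - real k) * Bernstein (Suc n) k x"
proof (cases k)
  case 0
  then show ?thesis by (simp add: Bernstein_def)
next
  case (Suc j)
  have "real (Suc n) * ((1 - x) * Bernstein n k x)
      = real (Suc n) * Bernstein (Suc n) (Suc j) x - real (Suc n) * (x * Bernstein n j x)"
    by (simp add: Bernstein_Suc_Suc Suc algebra_simps)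
  also have "\<dots> = (real (Suc n) - real k) * Bernstein (Suc n) k x"
    unfolding mult_x_Bernstein Suc by (simp add: algebra_simps)
  finally show ?thesis .
qed

text \<open>After expansion, both products on the left are multiples of the same polynomial of
  degree \<open>Suc n\<close>, by the two absorption identities. The resulting factor is the
  deviation of \<open>Suc k\<close> from the binomial mean, which brings sums of such differences
  within reach of the second central moment.\<close>

lemma Bernstein_diff_Suc:
  "real (Suc n) * (x * (1 - x)) * (Bernstein n k x - Bernstein n (Suc k) x)
     = (real (Suc k) - real (Suc n) * x) * Bernstein (Suc n) (Suc k) x"
proof -
  have "real (Suc n) * (x * (1 - x)) * (Bernstein n k x - Bernstein n (Suc k) x)
      = (1 - x) * (real (Suc n) * (x * Bernstein n k x))
        - x * (real (Suc n) * ((1 - x) * Bernstein n (Suc k) x))"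
    by (simp add: algebra_simps)
  also have "\<dots> = (1 - x) * (real (Suc k) * Bernstein (Suc n) (Suc k) x)
        - x * ((real (Suc n) - real (Suc k)) * Bernstein (Suc n) (Suc k) x)"
    unfolding mult_x_Bernstein mult_one_minus_x_Bernstein ..
  finally show ?thesis by (simp add: algebra_simps)
qed

lemma has_field_derivative_Bernstein:
  "(Bernstein (Suc n) (Suc k) has_field_derivative
      real (Suc n) * (Bernstein n k x - Bernstein n (Suc k) x)) (at x within S)"
proof -
  have *: "real (Suc k) * real (Suc n choose Suc k) = real (Suc n) * real (n choose k)"
    by (metis Suc_times_binomial of_nat_mult)
  have "(n - k) * (Suc n choose Suc k) = Suc n * (n choose Suc k)"
    using binomial_absorb_comp[of "Suc n" "Suc k"] by simp
  then have **: "real (n - k) * real (Suc n choose Suc k) = real (Suc n) * real (n choose Suc k)"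
    by (metis of_nat_mult)
  have "(Bernstein (Suc n) (Suc k) has_field_derivative
      real (Suc k) * real (Suc n choose Suc k) * (x ^ k * (1 - x) ^ (n - k))
      - real (n - k) * real (Suc n choose Suc k) * (x ^ Suc k * (1 - x) ^ (n - Suc k)))
      (at x within S)"
    unfolding Bernstein_def
    by (rule derivative_eq_intros refl | simp add: algebra_simps del: of_nat_Suc binomial_Suc_Suc)+
  then show ?thesis
    unfolding * ** by (simp add: Bernstein_def algebra_simps)
qed

lemma Bernstein_second_central_moment:
  "(\<Sum>k\<le>n. (real k - real n * x)\<^sup>2 * Bernstein n k x) = real n * (x * (1 - x))"
proof -
  have "(\<Sum>k\<le>n. (real k - real n * x)\<^sup>2 * Bernstein n k x)
      = (\<Sum>k\<le>n. real k * (real k - 1) * Bernstein n k x)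
        + (1 - 2 * (real n * x)) * (\<Sum>k\<le>n. real k * Bernstein n k x)
        + (real n * x)\<^sup>2 * (\<Sum>k\<le>n. Bernstein n k x)"
    unfolding sum_distrib_left sum.distrib[symmetric]
    by (intro sum.cong refl) (simp add: power2_eq_square algebra_simps)
  also have "\<dots> = real n * (x * (1 - x))"
    unfolding sum_kk_Bernstein sum_k_Bernstein sum_Bernstein
    by (simp add: power2_eq_square algebra_simps)
  finally show ?thesis .
qed

text \<open>Telescoping \<open>Bernstein_diff_Suc\<close> turns the value into a partial sum of
  deviations from the mean. It is bounded by the first absolute central moment of the binomial
  distribution with parameters \<open>Suc n\<close> and \<open>x\<close>, which is of the order of
  \<open>sqrt (Suc n)\<close>.\<close>

lemma Bernstein_le_inverse_sqrt:
  assumes x: "0 < x" "x < 1"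
  shows "Bernstein n k x \<le> 1 / (x * (1 - x)) * (1 / sqrt (real (Suc n)))"
proof (cases "k \<le> n")
  case True
  define N where "N = Suc n"
  define d where "d i = real i - real N * x" for i
  have N: "real N > 0" by (simp add: N_def)
  have B: "0 \<le> Bernstein m j x" for m j using x by (simp add: Bernstein_nonneg)
  have x1: "x * (1 - x) \<le> 1" using x by (simp add: mult_le_one)
  \<comment> \<open>The upper end contributes nothing because \<open>Bernstein n (Suc n) x\<close>
    is 0.\<close>
  have "Bernstein n k x = (\<Sum>j=k..<Suc n. Bernstein n j x - Bernstein n (Suc j) x)"
    using sum_Suc_diff'[of k "Suc n" "\<lambda>j. - Bernstein n j x"] True
    by (simp del: sum.op_ivl_Suc)
  then have "real N * (x * (1 - x)) * Bernstein n k x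
      = (\<Sum>j=k..<Suc n. d (Suc j) * Bernstein N (Suc j) x)"
    by (simp add: sum_distrib_left Bernstein_diff_Suc d_def N_def del: of_nat_Suc sum.op_ivl_Suc)
  also have "\<dots> = (\<Sum>i=Suc k..<Suc N. d i * Bernstein N i x)"
    unfolding N_def by (rule sum.shift_bounds_Suc_ivl[symmetric])
  also have "\<dots> \<le> (\<Sum>i=Suc k..<Suc N. \<bar>d i\<bar> * Bernstein N i x)"
    by (intro sum_mono mult_right_mono B) auto
  also have "\<dots> \<le> (\<Sum>i\<le>N. \<bar>d i\<bar> * Bernstein N i x)"
    by (intro sum_mono2) (auto simp: B)
  \<comment> \<open>The inequality of arithmetic and geometric means; the weight
    \<open>sqrt N\<close> balances the two terms, since the mean of \<open>(d i)\<^sup>2\<close> is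
    at most \<open>N\<close>.\<close>
  also have "\<dots> \<le> (\<Sum>i\<le>N. (sqrt (real N) + (d i)\<^sup>2 / sqrt (real N)) / 2 * Bernstein N i x)"
  proof (intro sum_mono mult_right_mono B)
    fix i
    have "2 * (sqrt (real N) * \<bar>d i\<bar>) \<le> (sqrt (real N))\<^sup>2 + (d i)\<^sup>2"
      using sum_squares_bound[of "sqrt (real N)" "\<bar>d i\<bar>"] by simp
    then show "\<bar>d i\<bar> \<le> (sqrt (real N) + (d i)\<^sup>2 / sqrt (real N)) / 2"
      using N by (simp add: field_simps power2_eq_square)
  qed
  also have "\<dots> = sqrt (real N) / 2 * (\<Sum>i\<le>N. Bernstein N i x)
      + 1 / (2 * sqrt (real N)) * (\<Sum>i\<le>N. (d i)\<^sup>2 * Bernstein N i x)"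
    by (simp add: sum_distrib_left sum.distrib[symmetric] field_simps del: sum_Bernstein)
  also have "\<dots> = sqrt (real N) / 2 + 1 / (2 * sqrt (real N)) * (real N * (x * (1 - x)))"
    unfolding d_def Bernstein_second_central_moment by simp
  also have "\<dots> \<le> sqrt (real N) / 2 + 1 / (2 * sqrt (real N)) * (real N * 1)"
    using N x1 by (intro add_left_mono mult_left_mono) auto
  also have "\<dots> = sqrt (real N)"
    using N by (simp add: field_simps)
  finally have "real N * (x * (1 - x)) * Bernstein n k x \<le> sqrt (real N)" .
  then have "sqrt (real N) * (sqrt (real N) * (x * (1 - x) * Bernstein n k x)) \<le> sqrt (real N) * 1"
    using N by (simp add: mult.assoc[symmetric])
  then have "sqrt (real N) * (x * (1 - x) * Bernstein n k x) \<le> 1"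
    using N by (subst (asm) mult_le_cancel_left_pos) auto
  then show ?thesis
    using x N by (simp add: field_simps N_def)
next
  case False
  then show ?thesis using x by simp
qed

section \<open>Tails of the binomial distribution and integrals of Bernstein polynomials\<close>

definition Bernstein_tail :: "nat \<Rightarrow> nat \<Rightarrow> real \<Rightarrow> real" where
  "Bernstein_tail n k x = (\<Sum>j=k..<Suc n. Bernstein n j x)"

lemma Bernstein_tail_diff:
  "Bernstein_tail n k x - Bernstein_tail n (Suc k) x = Bernstein n k x"
proof (cases "k < Suc n")
  case True
  then show ?thesis
    by (simp add: Bernstein_tail_def sum.atLeast_Suc_lessThan del: sum.op_ivl_Suc)
next
  case False
  then show ?thesis by (simp add: Bernstein_tail_def Bernstein_def)
qed

lemma Bernstein_tail_0 [simp]: "Bernstein_tail n 0 x = 1"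
  unfolding Bernstein_tail_def atLeast0LessThan lessThan_Suc_atMost by simp

lemma Bernstein_tail_Suc_eq_0 [simp]: "Bernstein_tail n (Suc n) x = 0"
  by (simp add: Bernstein_tail_def)

text \<open>Conditioning on the outcome of one trial. For \<open>x\<close> in the unit interval,
  this places a tail for \<open>Suc n\<close> between two consecutive tails for \<open>n\<close>, so
  that it can tag the cell they bound.\<close>

lemma Bernstein_tail_Suc_Suc:
  "Bernstein_tail (Suc n) (Suc k) x = x * Bernstein_tail n k x + (1 - x) * Bernstein_tail n (Suc k) x"
proof -
  have "Bernstein_tail (Suc n) (Suc k) x = (\<Sum>j=k..<Suc n. Bernstein (Suc n) (Suc j) x)"
    unfolding Bernstein_tail_def by (rule sum.shift_bounds_Suc_ivl)
  also have "\<dots> = x * Bernstein_tail n k x + (1 - x) * (\<Sum>j=k..<Suc n. Bernstein n (Suc j) x)"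
    by (simp add: Bernstein_Suc_Suc Bernstein_tail_def sum.distrib sum_distrib_left
        del: sum.op_ivl_Suc)
  also have "(\<Sum>j=k..<Suc n. Bernstein n (Suc j) x) = (\<Sum>j=Suc k..<Suc (Suc n). Bernstein n j x)"
    by (rule sum.shift_bounds_Suc_ivl[symmetric])
  \<comment> \<open>The shifted range may contain the extra index \<open>Suc n\<close>, where the
    polynomial vanishes.\<close>
  also have "\<dots> = Bernstein_tail n (Suc k) x"
    by (simp add: Bernstein_tail_def del: sum.shift_bounds_Suc_ivl)
  finally show ?thesis .
qed

text \<open>The termwise derivatives are differences of consecutive polynomials of degree
  \<open>n\<close>, and they telescope. Hence tails are antiderivatives of Bernstein
  polynomials.\<close>

lemma has_field_derivative_Bernstein_tail:
  assumes "k \<le> n"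
  shows "(Bernstein_tail (Suc n) (Suc k) has_field_derivative real (Suc n) * Bernstein n k x)
           (at x within S)"
proof -
  have "((\<lambda>x. \<Sum>j=k..<Suc n. Bernstein (Suc n) (Suc j) x) has_field_derivative
      (\<Sum>j=k..<Suc n. real (Suc n) * (Bernstein n j x - Bernstein n (Suc j) x))) (at x within S)"
    by (intro DERIV_sum has_field_derivative_Bernstein)
  moreover have "(\<Sum>j=k..<Suc n. real (Suc n) * (Bernstein n j x - Bernstein n (Suc j) x))
      = real (Suc n) * Bernstein n k x"
    using sum_Suc_diff'[of k "Suc n" "\<lambda>j. - Bernstein n j x"] assms
    by (simp add: sum_distrib_left[symmetric] del: sum.op_ivl_Suc of_nat_Suc)
  moreover have "Bernstein_tail (Suc n) (Suc k) = (\<lambda>x. \<Sum>j=k..<Suc n. Bernstein (Suc n) (Suc j) x)"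
    unfolding Bernstein_tail_def by (rule ext) (rule sum.shift_bounds_Suc_ivl)
  ultimately show ?thesis by simp
qed

lemma continuous_on_Bernstein [continuous_intros]: "continuous_on S (Bernstein n k)"
  unfolding Bernstein_def by (intro continuous_intros)

lemma borel_measurable_Bernstein [measurable]: "Bernstein n k \<in> borel_measurable borel"
  by (intro borel_measurable_continuous_onI continuous_on_Bernstein)

lemma set_integral_Bernstein:
  assumes "k \<le> n" "a \<le> b"
  shows "real (Suc n) * (LINT t:{a..b}|lborel. Bernstein n k t)
           = Bernstein_tail (Suc n) (Suc k) b - Bernstein_tail (Suc n) (Suc k) a"
proof -
  have "(LINT t:{a..b}|lborel. real (Suc n) * Bernstein n k t)
      = Bernstein_tail (Suc n) (Suc k) b - Bernstein_tail (Suc n) (Suc k) a"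
    unfolding set_lebesgue_integral_def real_scaleR_def
    using integral_FTC_atLeastAtMost[OF \<open>a \<le> b\<close>, of "Bernstein_tail (Suc n) (Suc k)"
        "\<lambda>t. real (Suc n) * Bernstein n k t"]
      has_field_derivative_Bernstein_tail[OF \<open>k \<le> n\<close>]
    by (simp add: has_real_derivative_iff_has_vector_derivative[symmetric] continuous_intros
        del: of_nat_Suc)
  then show ?thesis by (simp del: of_nat_Suc)
qed

lemma Bernstein_tail_at_0 [simp]: "Bernstein_tail n (Suc k) 0 = 0"
  by (simp add: Bernstein_tail_def Bernstein_def)

lemma Bernstein_tail_at_1 [simp]: "k \<le> n \<Longrightarrow> Bernstein_tail n k 1 = 1"
  by (induction "n - k" arbitrary: k)
    (auto simp: Bernstein_tail_def Bernstein_def power_0_left sum.delta if_distrib cong: if_cong)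

section \<open>Riemann sums over binomial tails\<close>

text \<open>On each cell, the integral and the tagged term both lie between the cell length times
  the values of \<open>h\<close> at the two ends. The error is thus at most \<open>\<delta>\<close>
  times the increase of \<open>h\<close> over the cell, and these increases telescope. The points
  \<open>T k\<close> run from right to left, as the tails do.\<close>

lemma Riemann_sum_mono_error:
  fixes h :: "real \<Rightarrow> real" and T U :: "nat \<Rightarrow> real"
  assumes h: "mono_on {T m..T 0} h"
    and U: "\<And>k. k < m \<Longrightarrow> U k \<in> {T (Suc k)..T k}"
    and mesh: "\<And>k. k < m \<Longrightarrow> T k - T (Suc k) \<le> \<delta>"
  shows "\<bar>(\<Sum>k<m. (T k - T (Suc k)) * h (U k)) - integral {T m..T 0} h\<bar> \<le> \<delta> * (h (T 0) - h (T m))"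
  using assms
proof (induction m)
  case (Suc m)
  have le: "T (Suc m) \<le> T m" using Suc.prems(2)[of m] by auto
  \<comment> \<open>Freezing the sequence at index \<open>m\<close> by \<open>min\<close> makes it
    decreasing on all naturals.\<close>
  have le0: "T m \<le> T 0"
  proof (rule lift_Suc_antimono_le[of "\<lambda>k. T (min k m)", of 0 m, simplified])
    fix k show "T (min (Suc k) m) \<le> T (min k m)"
      using Suc.prems(2)[of k] by (cases "k < m") (auto simp: min_def not_less)
  qed
  have IH: "\<bar>(\<Sum>k<m. (T k - T (Suc k)) * h (U k)) - integral {T m..T 0} h\<bar> \<le> \<delta> * (h (T 0) - h (T m))"
    using Suc.prems le by (intro Suc.IH) (auto intro: mono_on_subset)
  have int: "h integrable_on {T (Suc m)..T 0}"
    using Suc.prems(1) by (rule integrable_on_mono_on)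
  have mono: "mono_on {T (Suc m)..T m} h"
    using Suc.prems(1) by (rule mono_on_subset) (use le0 in auto)
  have int': "h integrable_on {T (Suc m)..T m}"
    using mono by (rule integrable_on_mono_on)
  have split: "integral {T (Suc m)..T 0} h = integral {T (Suc m)..T m} h + integral {T m..T 0} h"
    using Henstock_Kurzweil_Integration.integral_combine[OF le le0 int] by simp
  define p where "p = T m - T (Suc m)"
  have p: "0 \<le> p" "p \<le> \<delta>" using le Suc.prems(3)[of m] by (auto simp: p_def)
  have lo: "p * h (T (Suc m)) \<le> integral {T (Suc m)..T m} h"
    using integral_le[of "\<lambda>_. h (T (Suc m))" "{T (Suc m)..T m}" h] int' mono le
    by (auto simp: p_def mono_on_def)
  have hi: "integral {T (Suc m)..T m} h \<le> p * h (T m)"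
    using integral_le[of h "{T (Suc m)..T m}" "\<lambda>_. h (T m)"] int' mono le
    by (auto simp: p_def mono_on_def)
  have Um: "U m \<in> {T (Suc m)..T m}" using Suc.prems(2) by simp
  have "h (T (Suc m)) \<le> h (U m)" "h (U m) \<le> h (T m)"
    using mono Um le by (auto simp: mono_on_def)
  then have "p * h (T (Suc m)) \<le> p * h (U m)" "p * h (U m) \<le> p * h (T m)"
    "p * (h (T m) - h (T (Suc m))) \<le> \<delta> * (h (T m) - h (T (Suc m)))"
    using p by (auto intro!: mult_left_mono mult_right_mono)
  then have "\<bar>p * h (U m) - integral {T (Suc m)..T m} h\<bar> \<le> \<delta> * (h (T m) - h (T (Suc m)))"
    using lo hi by (simp add: abs_le_iff right_diff_distrib)
  then show ?case
    using IH unfolding split by (simp add: p_def[symmetric] right_diff_distrib)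
qed simp

lemma Bernstein_Riemann_sum_mono:
  fixes h :: "real \<Rightarrow> real"
  assumes x: "0 < x" "x < 1" and h: "mono_on {0..1} h"
  shows "(\<lambda>n. \<Sum>k\<le>n. Bernstein n k x * h (Bernstein_tail (Suc n) (Suc k) x))
           \<longlonglongrightarrow> integral {0..1} h"
proof (rule LIM_zero_cancel, rule Lim_null_comparison)
  define \<delta> where "\<delta> n = 1 / (x * (1 - x)) * (1 / sqrt (real (Suc n)))" for n
  show "\<forall>\<^sub>F n in sequentially.
      norm ((\<Sum>k\<le>n. Bernstein n k x * h (Bernstein_tail (Suc n) (Suc k) x)) - integral {0..1} h)
        \<le> \<delta> n * (h 1 - h 0)"
  proof (rule always_eventually, rule allI)
    fix n
    have "Bernstein_tail (Suc n) (Suc k) x \<in> {Bernstein_tail n (Suc k) x..Bernstein_tail n k x}" for k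
    proof -
      have le: "Bernstein_tail n (Suc k) x \<le> Bernstein_tail n k x"
        using Bernstein_tail_diff[of n k x] Bernstein_nonneg[of x n k] x by linarith
      \<comment> \<open>The tag is the lower end plus \<open>x * d\<close> and the upper end minus
        \<open>(1 - x) * d\<close>.\<close>
      define d where "d = Bernstein_tail n k x - Bernstein_tail n (Suc k) x"
      have "0 \<le> x * d" "0 \<le> (1 - x) * d" using x le by (auto simp: d_def)
      then show ?thesis
        unfolding Bernstein_tail_Suc_Suc d_def by (simp add: algebra_simps)
    qed
    then have "\<bar>(\<Sum>k<Suc n. (Bernstein_tail n k x - Bernstein_tail n (Suc k) x)
          * h (Bernstein_tail (Suc n) (Suc k) x)) - integral {Bernstein_tail n (Suc n) x..Bernstein_tail n 0 x} h\<bar>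
        \<le> \<delta> n * (h (Bernstein_tail n 0 x) - h (Bernstein_tail n (Suc n) x))"
      using h Bernstein_le_inverse_sqrt[OF x]
      by (intro Riemann_sum_mono_error) (auto simp: Bernstein_tail_diff \<delta>_def)
    then show "norm ((\<Sum>k\<le>n. Bernstein n k x * h (Bernstein_tail (Suc n) (Suc k) x)) - integral {0..1} h)
        \<le> \<delta> n * (h 1 - h 0)"
      by (simp only: Bernstein_tail_diff Bernstein_tail_0 Bernstein_tail_Suc_eq_0 lessThan_Suc_atMost
          real_norm_def)
  qed
  have "\<delta> \<longlonglongrightarrow> 0" unfolding \<delta>_def by real_asymp
  then show "(\<lambda>n. \<delta> n * (h 1 - h 0)) \<longlonglongrightarrow> 0"
    by (auto intro: tendsto_eq_intros)
qed

lemma Bernstein_Riemann_sum_antimono: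
  fixes h :: "real \<Rightarrow> real"
  assumes x: "0 < x" "x < 1" and h: "antimono_on {0..1} h"
  shows "(\<lambda>n. \<Sum>k\<le>n. Bernstein n k x * h (Bernstein_tail (Suc n) (Suc k) x))
           \<longlonglongrightarrow> integral {0..1} h"
proof -
  have "mono_on {0..1} (\<lambda>u. - h u)"
    using h by (auto simp: monotone_on_def)
  from tendsto_minus[OF Bernstein_Riemann_sum_mono[OF x this]] show ?thesis
    by (simp add: sum_negf)
qed

section \<open>Localisation of unweighted Durrmeyer means\<close>

lemma set_integrable_bounded_borel:
  fixes g :: "real \<Rightarrow> real"
  assumes "g \<in> borel_measurable borel" "\<And>t. t \<in> {a..b} \<Longrightarrow> \<bar>g t\<bar> \<le> K"
  shows "set_integrable lborel {a..b} g"
  unfolding set_integrable_def using assms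
  by (intro integrableI_bounded_set_indicator[where B = K]) (auto simp: emeasure_lborel_Icc_eq)

lemma set_integrable_mult_Bernstein:
  fixes g :: "real \<Rightarrow> real"
  assumes [measurable]: "g \<in> borel_measurable borel" and K: "\<And>t. t \<in> {0..1} \<Longrightarrow> \<bar>g t\<bar> \<le> K"
  shows "set_integrable lborel {0..1} (\<lambda>t. g t * Bernstein n k t)"
proof (rule set_integrable_bounded_borel[where K = "K * 1"])
  fix t :: real assume t: "t \<in> {0..1}"
  have "Bernstein n k t \<le> 1"
  proof (cases "k \<le> n")
    case True
    then have "Bernstein n k t \<le> (\<Sum>j\<le>n. Bernstein n j t)"
      using t by (intro member_le_sum) (auto simp: Bernstein_nonneg)
    then show ?thesis by simp
  qed simp
  then show "\<bar>g t * Bernstein n k t\<bar> \<le> K * 1"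
    using K[OF t] t unfolding abs_mult by (intro mult_mono) (auto simp: Bernstein_nonneg)
qed simp

lemma set_integrable_Bernstein: "set_integrable lborel {a..b} (Bernstein n k)"
  by (intro borel_integrable_atLeastAtMost' continuous_on_Bernstein)

text \<open>On the unit interval, \<open>Suc n\<close> times \<open>Bernstein n k\<close> is the
  density of the beta distribution with parameters \<open>k + 1\<close> and
  \<open>n - k + 1\<close>. Absorbing a factor \<open>t\<close> raises both indices by one, and
  every polynomial of degree \<open>m\<close> has integral \<open>1 / (m + 1)\<close>.\<close>

lemma Bernstein_second_moment_integral:
  assumes k: "k \<le> n"
  shows "real (Suc n) * (LINT t:{0..1}|lborel. (t - y)\<^sup>2 * Bernstein n k t)
    = (real k + 1) * (real k + 2) / ((real n + 2) * (real n + 3))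
      - 2 * y * ((real k + 1) / (real n + 2)) + y\<^sup>2"
proof -
  have int: "(LINT t:{0..1}|lborel. Bernstein m j t) = 1 / real (Suc m)" if "j \<le> m" for m j
    using set_integral_Bernstein[OF that, of 0 1] that by (simp add: field_simps del: of_nat_Suc)
  define c1 where "c1 = (real k + 1) / (real n + 1)"
  define c2 where "c2 = (real k + 2) / (real n + 2)"
  have m1: "t * Bernstein n k t = c1 * Bernstein (Suc n) (Suc k) t" for t
    using mult_x_Bernstein[of n t k] by (simp add: c1_def field_simps)
  have m2: "t * Bernstein (Suc n) (Suc k) t = c2 * Bernstein (Suc (Suc n)) (Suc (Suc k)) t" for t
    using mult_x_Bernstein[of "Suc n" t "Suc k"] by (simp add: c2_def field_simps)
  have "(t - y)\<^sup>2 * Bernstein n k t = t * (t * Bernstein n k t) - 2 * y * (t * Bernstein n k t)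
      + y\<^sup>2 * Bernstein n k t" for t
    by (simp add: power2_eq_square algebra_simps)
  also have "\<dots> t = c1 * c2 * Bernstein (Suc (Suc n)) (Suc (Suc k)) t
      - 2 * y * c1 * Bernstein (Suc n) (Suc k) t + y\<^sup>2 * Bernstein n k t" for t
    unfolding m1 mult.left_commute[of t c1] m2 by simp
  finally have "(LINT t:{0..1}|lborel. (t - y)\<^sup>2 * Bernstein n k t)
      = (LINT t:{0..1}|lborel. c1 * c2 * Bernstein (Suc (Suc n)) (Suc (Suc k)) t
      - 2 * y * c1 * Bernstein (Suc n) (Suc k) t + y\<^sup>2 * Bernstein n k t)"
    by simp
  also have "\<dots> = c1 * c2 * (1 / (real n + 3)) - 2 * y * c1 * (1 / (real n + 2)) + y\<^sup>2 * (1 / (real n + 1))"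
    using k by (simp add: set_integral_add set_integral_diff set_integrable_Bernstein int add.commute)
  finally have eq: "(LINT t:{0..1}|lborel. (t - y)\<^sup>2 * Bernstein n k t)
      = c1 * c2 * (1 / (real n + 3)) - 2 * y * c1 * (1 / (real n + 2)) + y\<^sup>2 * (1 / (real n + 1))" .
  have "real (Suc n) * (LINT t:{0..1}|lborel. (t - y)\<^sup>2 * Bernstein n k t)
      = (real (Suc n) * c1) * c2 * (1 / (real n + 3)) - 2 * y * (real (Suc n) * c1) * (1 / (real n + 2))
        + y\<^sup>2 * (real (Suc n) * (1 / (real n + 1)))"
    unfolding eq by (simp add: algebra_simps del: of_nat_Suc)
  moreover have "real (Suc n) * c1 = real k + 1" "real (Suc n) * (1 / (real n + 1)) = 1"
    by (simp_all add: c1_def field_simps)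
  ultimately show ?thesis
    unfolding c2_def by (simp only:) simp
qed

text \<open>The beta moments are quadratic in \<open>k\<close>, so the first two factorial moments
  of the binomial distribution evaluate the sum. In the coefficient of \<open>x\<^sup>2\<close> the
  limits 1, -2 and 1 cancel; the other coefficients are of order \<open>1 / n\<close> or
  smaller.\<close>

lemma Bernstein_mean_second_moment_integral:
  "(\<lambda>n. \<Sum>k\<le>n. Bernstein n k x * (real (Suc n) * (LINT t:{0..1}|lborel. (t - x)\<^sup>2 * Bernstein n k t)))
     \<longlonglongrightarrow> 0"
proof -
  have "(\<Sum>k\<le>n. Bernstein n k x * (real (Suc n) * (LINT t:{0..1}|lborel. (t - x)\<^sup>2 * Bernstein n k t)))
      = x\<^sup>2 * (real n * (real n - 1) / ((real n + 2) * (real n + 3)) - 2 * (real n / (real n + 2)) + 1)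
        + x * (4 * (real n / ((real n + 2) * (real n + 3))) - 2 / (real n + 2))
        + 2 / ((real n + 2) * (real n + 3))" (is "?L = ?R") for n
  proof -
    define q where "q = (real n + 2) * (real n + 3)"
    define r where "r = real n + 2"
    \<comment> \<open>The coefficients come from
      \<open>(k + 1) * (k + 2) = k * (k - 1) + 4 * k + 2\<close>, which fits the known factorial
      moments.\<close>
    have "?L = (\<Sum>k\<le>n. 1 / q * (real k * (real k - 1) * Bernstein n k x)
        + (4 / q - 2 * x / r) * (real k * Bernstein n k x)
        + (2 / q - 2 * x / r + x\<^sup>2) * Bernstein n k x)"
    proof (intro sum.cong refl)
      fix k assume "k \<in> {..n}"
      then have "real (Suc n) * (LINT t:{0..1}|lborel. (t - x)\<^sup>2 * Bernstein n k t)
          = (real k + 1) * (real k + 2) / q - 2 * x * ((real k + 1) / r) + x\<^sup>2"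
        by (subst Bernstein_second_moment_integral) (auto simp: q_def r_def)
      also have "\<dots> = 1 / q * (real k * (real k - 1)) + (4 / q - 2 * x / r) * real k
          + (2 / q - 2 * x / r + x\<^sup>2)"
        by (simp add: algebra_simps add_divide_distrib diff_divide_distrib)
      finally show "Bernstein n k x * (real (Suc n) * (LINT t:{0..1}|lborel. (t - x)\<^sup>2 * Bernstein n k t))
          = 1 / q * (real k * (real k - 1) * Bernstein n k x)
            + (4 / q - 2 * x / r) * (real k * Bernstein n k x)
            + (2 / q - 2 * x / r + x\<^sup>2) * Bernstein n k x"
        by (simp only:) (simp add: algebra_simps)
    qed
    also have "\<dots> = 1 / q * (real n * (real n - 1) * x\<^sup>2) + (4 / q - 2 * x / r) * (real n * x)
        + (2 / q - 2 * x / r + x\<^sup>2)"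
      unfolding sum.distrib sum_distrib_left[symmetric] sum_kk_Bernstein sum_k_Bernstein sum_Bernstein
      by simp
    also have "\<dots> = ?R"
      unfolding q_def[symmetric] unfolding r_def[symmetric]
      by (simp add: algebra_simps power2_eq_square add_divide_distrib diff_divide_distrib)
    finally show ?thesis .
  qed
  moreover have "(\<lambda>n. x\<^sup>2 * (real n * (real n - 1) / ((real n + 2) * (real n + 3)) - 2 * (real n / (real n + 2)) + 1)
        + x * (4 * (real n / ((real n + 2) * (real n + 3))) - 2 / (real n + 2))
        + 2 / ((real n + 2) * (real n + 3))) \<longlonglongrightarrow> x\<^sup>2 * 0 + x * 0 + 0"
    by (intro tendsto_add tendsto_mult tendsto_const; real_asymp)
  ultimately show ?thesis
    by simp
qed

text \<open>Chebyshev's argument: \<psi> is small near \<open>x\<close>, and away from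
  \<open>x\<close> its bound \<open>K\<close> is dominated by a multiple of
  \<open>(t - x)\<^sup>2\<close>, whose mean tends to 0.\<close>

lemma set_integral_mult_Bernstein_tendsto_0:
  fixes \<psi> :: "real \<Rightarrow> real"
  assumes x: "0 < x" "x < 1" and \<psi>_meas [measurable]: "\<psi> \<in> borel_measurable borel"
    and \<psi>: "\<And>t. t \<in> {0..1} \<Longrightarrow> 0 \<le> \<psi> t" "\<And>t. t \<in> {0..1} \<Longrightarrow> \<psi> t \<le> K"
    and lim: "(\<psi> \<longlongrightarrow> 0) (at x)"
  shows "(\<lambda>n. \<Sum>k\<le>n. Bernstein n k x * (real (Suc n) * (LINT t:{0..1}|lborel. \<psi> t * Bernstein n k t)))
           \<longlonglongrightarrow> 0" (is "?S \<longlonglongrightarrow> 0")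
proof (rule LIMSEQ_I)
  fix r :: real assume r: "0 < r"
  define s where "s n = (\<Sum>k\<le>n. Bernstein n k x *
    (real (Suc n) * (LINT t:{0..1}|lborel. (t - x)\<^sup>2 * Bernstein n k t)))" for n
  have B: "0 \<le> Bernstein n k x" for n k using x by (simp add: Bernstein_nonneg)
  have "eventually (\<lambda>t. \<psi> t < r / 2) (at x)"
    using lim r by (intro order_tendstoD) auto
  then obtain \<eta> where \<eta>: "0 < \<eta>" "\<And>t. t \<noteq> x \<Longrightarrow> \<bar>t - x\<bar> < \<eta> \<Longrightarrow> \<psi> t < r / 2"
    by (auto simp: eventually_at dist_real_def)
  have K: "0 \<le> K" using \<psi>[of 0] by simp
  \<comment> \<open>Chosen so that \<open>K \<le> C * (t - x)\<^sup>2\<close> as soon as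
    \<open>t\<close> is at least \<eta> away from \<open>x\<close>.\<close>
  define C where "C = K / \<eta>\<^sup>2"
  have C: "0 \<le> C" using K by (simp add: C_def)
  have bound: "\<psi> t \<le> r / 2 + C * (t - x)\<^sup>2" if t: "t \<in> {0..1}" "t \<noteq> x" for t
  proof (cases "\<bar>t - x\<bar> < \<eta>")
    case True
    then show ?thesis using \<eta>(2)[OF t(2)] C by (smt (verit) mult_nonneg_nonneg zero_le_power2)
  next
    case False
    then have "\<eta>\<^sup>2 \<le> (t - x)\<^sup>2" using \<eta>(1) abs_le_square_iff[of \<eta> "t - x"] by simp
    then have "K * \<eta>\<^sup>2 \<le> K * (t - x)\<^sup>2" using K by (rule mult_left_mono)
    then have "K \<le> C * (t - x)\<^sup>2" using \<eta>(1) by (simp add: C_def field_simps)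
    then show ?thesis using \<psi>(2)[OF t(1)] r by linarith
  qed
  have le: "?S n \<le> r / 2 + C * s n" for n
  proof -
    have "real (Suc n) * (LINT t:{0..1}|lborel. \<psi> t * Bernstein n k t)
        \<le> r / 2 + C * (real (Suc n) * (LINT t:{0..1}|lborel. (t - x)\<^sup>2 * Bernstein n k t))"
      if k: "k \<le> n" for k
    proof -
      have int2: "set_integrable lborel {0..1} (\<lambda>t. (t - x)\<^sup>2 * Bernstein n k t)"
        using x by (intro borel_integrable_atLeastAtMost' continuous_intros)
      have "(LINT t:{0..1}|lborel. \<psi> t * Bernstein n k t)
          \<le> (LINT t:{0..1}|lborel. r / 2 * Bernstein n k t + C * ((t - x)\<^sup>2 * Bernstein n k t))"
      proof (rule set_integral_mono_AE)
        show "set_integrable lborel {0..1} (\<lambda>t. \<psi> t * Bernstein n k t)"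
          using \<psi> by (intro set_integrable_mult_Bernstein[where K = K]) auto
        show "set_integrable lborel {0..1} (\<lambda>t. r / 2 * Bernstein n k t + C * ((t - x)\<^sup>2 * Bernstein n k t))"
          by (intro borel_integrable_atLeastAtMost' continuous_intros)
        show "AE t\<in>{0..1} in lborel. \<psi> t * Bernstein n k t
            \<le> r / 2 * Bernstein n k t + C * ((t - x)\<^sup>2 * Bernstein n k t)"
          \<comment> \<open>The limit at \<open>x\<close> says nothing about the value
            \<open>\<psi> x\<close>, so this one point is discarded as a null set.\<close>
          using AE_lborel_singleton[of x]
        proof eventually_elim
          case (elim t)
          then show ?case
            using mult_right_mono[OF bound, of t "Bernstein n k t"]
            by (auto simp: Bernstein_nonneg algebra_simps)
        qed
      qed
      also have "\<dots> = r / 2 * (LINT t:{0..1}|lborel. Bernstein n k t)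
          + C * (LINT t:{0..1}|lborel. (t - x)\<^sup>2 * Bernstein n k t)"
        using int2 by (simp add: set_integral_add set_integrable_Bernstein)
      finally have "real (Suc n) * (LINT t:{0..1}|lborel. \<psi> t * Bernstein n k t)
          \<le> r / 2 * (real (Suc n) * (LINT t:{0..1}|lborel. Bernstein n k t))
          + C * (real (Suc n) * (LINT t:{0..1}|lborel. (t - x)\<^sup>2 * Bernstein n k t))"
        using mult_left_mono[of _ _ "real (Suc n)"] by (fastforce simp: algebra_simps)
      then show ?thesis
        using set_integral_Bernstein[OF k, of 0 1] k by (simp del: of_nat_Suc)
    qed
    then have "?S n \<le> (\<Sum>k\<le>n. Bernstein n k x *
        (r / 2 + C * (real (Suc n) * (LINT t:{0..1}|lborel. (t - x)\<^sup>2 * Bernstein n k t))))"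
      by (intro sum_mono mult_left_mono B) auto
    also have "\<dots> = r / 2 * (\<Sum>k\<le>n. Bernstein n k x) + C * s n"
      unfolding s_def sum_distrib_left sum.distrib[symmetric]
      by (intro sum.cong refl) (simp add: algebra_simps)
    finally show ?thesis by simp
  qed
  have ge: "0 \<le> ?S n" for n
    unfolding set_lebesgue_integral_def
    by (intro sum_nonneg mult_nonneg_nonneg B integral_nonneg_AE AE_I2)
      (auto simp: indicator_def \<psi> Bernstein_nonneg)
  have lim_s: "(\<lambda>n. r / 2 + C * s n) \<longlonglongrightarrow> r / 2 + C * 0"
    using Bernstein_mean_second_moment_integral[of x] unfolding s_def by (intro tendsto_intros)
  have "eventually (\<lambda>n. r / 2 + C * s n < r) sequentially"
    using r by (intro order_tendstoD(2)[OF lim_s]) auto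
  then have "eventually (\<lambda>n. norm (?S n - 0) < r) sequentially"
  proof eventually_elim
    case (elim n)
    have "norm (?S n - 0) = ?S n"
      unfolding real_norm_def diff_zero by (rule abs_of_nonneg[OF ge])
    with le[of n] elim show ?case by linarith
  qed
  then show "\<exists>N. \<forall>n\<ge>N. norm (?S n - 0) < r"
    unfolding eventually_sequentially .
qed

section \<open>Step weights\<close>

text \<open>For positive denominators, cross-multiplication leaves the difference
  \<open>a * b * (v - u)\<close>, which is non-negative.\<close>

lemma antimono_on_mixture_weight:
  fixes a b :: real
  assumes "0 \<le> a" "0 \<le> b"
  shows "antimono_on {0..1} (\<lambda>u. b * (1 - u) / (a * u + b * (1 - u)))"
proof (rule monotone_onI)
  fix u v :: real assume uv: "u \<in> {0..1}" "v \<in> {0..1}" "u \<le> v"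
  define D where "D u = a * u + b * (1 - u)" for u
  have D: "0 \<le> D u" "0 \<le> D v" using uv assms by (auto simp: D_def)
  have "b * (1 - v) / D v \<le> b * (1 - u) / D u"
  proof (cases "D u = 0 \<or> D v = 0")
    case True
    \<comment> \<open>Division by 0 yields 0. If \<open>D v = 0\<close>, the left side is 0. If
      \<open>D u = 0\<close>, then \<open>b = 0\<close> or \<open>u = 1\<close>, and
      \<open>u = 1\<close> forces \<open>v = 1\<close>; the left numerator vanishes either
      way.\<close>
    have "b * (1 - v) = 0" if "D u = 0"
    proof -
      have "a * u = 0" "b * (1 - u) = 0"
        using that assms uv add_nonneg_eq_0_iff[of "a * u" "b * (1 - u)"] by (auto simp: D_def)
      then show ?thesis using uv by auto
    qed
    then show ?thesis using True D uv assms by (auto intro!: divide_nonneg_nonneg)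
  next
    case False
    with D have "0 < D u" "0 < D v" by auto
    moreover have "b * a * u \<le> b * a * v" using assms uv by (intro mult_left_mono) auto
    then have "b * (1 - v) * D u \<le> b * (1 - u) * D v" by (simp add: D_def algebra_simps)
    ultimately show ?thesis by (simp add: field_simps)
  qed
  then show "b * (1 - u) / (a * u + b * (1 - u)) \<ge> b * (1 - v) / (a * v + b * (1 - v))"
    by (simp add: D_def)
qed

lemma mixture_weight_bounds:
  fixes a b u :: real
  assumes "0 \<le> a" "0 \<le> b" "u \<in> {0..1}"
  shows "0 \<le> b * (1 - u) / (a * u + b * (1 - u))" "b * (1 - u) / (a * u + b * (1 - u)) \<le> 1"
  using assms by (auto intro!: divide_nonneg_nonneg divide_le_eq_1[THEN iffD2]
      simp: less_le add_nonneg_eq_0_iff)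

section \<open>Mass of the indices with a small step denominator\<close>

lemma integral_le_length:
  fixes h :: "real \<Rightarrow> real"
  assumes h: "h integrable_on {0..1}" and cd: "0 \<le> c" "c \<le> d" "d \<le> 1"
    and le: "\<And>u. u \<in> {0..1} \<Longrightarrow> h u \<le> (if u \<in> {c..d} then 1 else 0)"
  shows "integral {0..1} h \<le> d - c"
proof -
  have 1: "{c..d} \<inter> {0..1} = {c..d}" using cd by auto
  have "(\<lambda>u. if u \<in> {c..d} then 1 else 0 :: real) integrable_on {0..1}"
    unfolding integrable_restrict_Int 1 by (rule integrable_const_ivl)
  from integral_le[OF h this] le
  have "integral {0..1} h \<le> integral {0..1} (\<lambda>u. if u \<in> {c..d} then 1 else 0 :: real)"
    by blast
  also have "\<dots> = d - c"
    unfolding integral_restrict_Int 1 using cd by simp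
  finally show ?thesis .
qed

lemma Bernstein_tail_in_unit:
  assumes "0 \<le> x" "x \<le> 1"
  shows "Bernstein_tail n k x \<in> {0..1}"
proof -
  have B: "0 \<le> Bernstein n j x" for j using assms by (simp add: Bernstein_nonneg)
  have "Bernstein_tail n k x \<le> (\<Sum>j\<le>n. Bernstein n j x)"
    unfolding Bernstein_tail_def by (intro sum_mono2) (auto simp: B)
  moreover have "0 \<le> Bernstein_tail n k x"
    unfolding Bernstein_tail_def by (intro sum_nonneg B)
  ultimately show ?thesis by simp
qed

text \<open>The affine function \<open>a * u + b * (1 - u)\<close> is at least \<open>a * u\<close>,
  so for \<open>a > 0\<close> it is below \<open>a * e\<close> only when \<open>u < e\<close>; for
  \<open>a = 0\<close> it is below \<open>b * e\<close> only when \<open>u > 1 - e\<close>. The mass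
  of such indices is at most a Riemann sum of the indicator of an interval of length
  \<open>e\<close>.\<close>

lemma Bernstein_mass_small_mixture:
  fixes a b :: real
  assumes x: "0 < x" "x < 1" and ab: "0 \<le> a" "0 \<le> b" "a \<noteq> 0 \<or> b \<noteq> 0" and \<epsilon>: "0 < \<epsilon>"
  defines "U \<equiv> \<lambda>n k. Bernstein_tail (Suc n) (Suc k) x"
  shows "\<exists>\<theta>>0. \<forall>\<^sub>F n in sequentially.
    (\<Sum>k\<le>n. Bernstein n k x * (if a * U n k + b * (1 - U n k) < \<theta> then 1 else 0)) < \<epsilon>"
proof -
  \<comment> \<open>The cap keeps the interval inside the unit interval; halving leaves room for a
    strict inequality in the limit.\<close>
  define e where "e = min 1 (\<epsilon> / 2)"
  have e: "0 < e" "e \<le> 1" "e < \<epsilon>" using \<epsilon> by (auto simp: e_def)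
  have B: "0 \<le> Bernstein n k x" for n k using x by (simp add: Bernstein_nonneg)
  have U: "U n k \<in> {0..1}" for n k
    using Bernstein_tail_in_unit[of x "Suc n" "Suc k"] x by (simp add: U_def)
  \<comment> \<open>Common end of both cases: any \<open>h\<close> that dominates the indicator of
    the bad set, has integral at most \<open>e\<close> and has convergent Riemann sums
    suffices.\<close>
  have conclude: ?thesis
    if lim: "(\<lambda>n. \<Sum>k\<le>n. Bernstein n k x * h (U n k)) \<longlonglongrightarrow> integral {0..1} h"
      and int: "integral {0..1} h \<le> e" and \<theta>: "0 < \<theta>"
      and h: "\<And>u. u \<in> {0..1} \<Longrightarrow> (if a * u + b * (1 - u) < \<theta> then 1 else 0) \<le> h u"
    for h :: "real \<Rightarrow> real" and \<theta>
  proof (intro exI[of _ \<theta>] conjI \<theta>)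
    have "\<forall>\<^sub>F n in sequentially. (\<Sum>k\<le>n. Bernstein n k x * h (U n k)) < \<epsilon>"
      using int e by (intro order_tendstoD(2)[OF lim]) simp
    then show "\<forall>\<^sub>F n in sequentially.
        (\<Sum>k\<le>n. Bernstein n k x * (if a * U n k + b * (1 - U n k) < \<theta> then 1 else 0)) < \<epsilon>"
    proof eventually_elim
      case (elim n)
      have "(\<Sum>k\<le>n. Bernstein n k x * (if a * U n k + b * (1 - U n k) < \<theta> then 1 else 0))
          \<le> (\<Sum>k\<le>n. Bernstein n k x * h (U n k))"
        by (intro sum_mono mult_left_mono h B U)
      with elim show ?case by simp
    qed
  qed
  show ?thesis
  proof (cases "a = 0")
    case False
    define h :: "real \<Rightarrow> real" where "h = (\<lambda>u. if u < e then 1 else 0)"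
    have anti: "antimono_on {0..1} h" by (auto simp: monotone_on_def h_def)
    have "(\<lambda>u. - h u) integrable_on {0..1}"
      using anti by (intro integrable_on_mono_on) (auto simp: monotone_on_def)
    then have "h integrable_on {0..1}" by (simp add: integrable_neg_iff)
    then have "integral {0..1} h \<le> e"
      using integral_le_length[of h 0 e] e by (auto simp: h_def)
    moreover have "(if a * u + b * (1 - u) < a * e then 1 else 0) \<le> h u" if "u \<in> {0..1}" for u
    proof -
      have "0 \<le> b * (1 - u)" using that ab by simp
      then have "a * u < a * e" if "a * u + b * (1 - u) < a * e" using that by linarith
      then show ?thesis using ab False by (auto simp: h_def)
    qed
    ultimately show ?thesis
      using Bernstein_Riemann_sum_antimono[OF x anti] ab False e
      by (intro conclude[of h "a * e"]) (auto simp: U_def)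
  next
    case True
    with ab have b: "0 < b" by simp
    define h :: "real \<Rightarrow> real" where "h = (\<lambda>u. if 1 - e < u then 1 else 0)"
    have mono: "mono_on {0..1} h" by (auto simp: monotone_on_def h_def)
    then have "h integrable_on {0..1}" by (rule integrable_on_mono_on)
    then have "integral {0..1} h \<le> e"
      using integral_le_length[of h "1 - e" 1] e by (auto simp: h_def)
    moreover have "(if a * u + b * (1 - u) < b * e then 1 else 0) \<le> h u" if "u \<in> {0..1}" for u
      using b True by (auto simp: h_def)
    ultimately show ?thesis
      using Bernstein_Riemann_sum_mono[OF x mono] b e
      by (intro conclude[of h "b * e"]) (auto simp: U_def)
  qed
qed

text \<open>The case \<open>D' = 0\<close> is included: then \<open>N' = 0\<close> and \<open>N' / D'\<close> is \<open>0 / 0 = 0\<close>.\<close>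

lemma quotient_perturbation:
  fixes N N' D D' :: real
  assumes D: "0 < D" and N': "\<bar>N'\<bar> \<le> F * D'"
    and G: "\<bar>N' - N\<bar> \<le> G" and E: "\<bar>D' - D\<bar> \<le> E" and F: "0 \<le> F" and D': "0 \<le> D'"
  shows "\<bar>N' / D' - N / D\<bar> \<le> (G + F * E) / D"
proof -
  define q where "q = N' / D'"
  have qD': "q * D' = N'" using N' by (auto simp: q_def)
  have q: "\<bar>q\<bar> \<le> F"
    using N' D' F by (cases "D' = 0") (auto simp: q_def divide_le_eq)
  \<comment> \<open>Letting the bounded quotient \<open>q\<close> multiply the error of the
    denominator leaves only \<open>D\<close> to divide by, so \<open>D'\<close> may be arbitrarily
    small.\<close>
  have "q - N / D = (q * (D - D') + (N' - N)) / D"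
    using D by (simp add: field_simps flip: qD')
  then have "\<bar>q - N / D\<bar> = \<bar>q * (D - D') + (N' - N)\<bar> / D"
    using D by simp
  also have "\<dots> \<le> (\<bar>q\<bar> * \<bar>D' - D\<bar> + \<bar>N' - N\<bar>) / D"
    using D abs_triangle_ineq[of "q * (D - D')" "N' - N"]
    by (intro divide_right_mono) (auto simp: abs_mult abs_minus_commute)
  also have "\<dots> \<le> (F * E + G) / D"
    using D q G E F by (intro divide_right_mono add_mono mult_mono) auto
  finally show ?thesis by (simp add: q_def add.commute)
qed

text \<open>The tail as a function of the point runs from 0 at 0 to 1 at 1, so the normalised mass
  of \<open>Bernstein n k\<close> is \<open>U\<close> to the left of \<open>x\<close> and
  \<open>1 - U\<close> to the right.\<close>

lemma set_integral_step_Bernstein: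
  fixes p q x :: real
  assumes x: "0 < x" "x < 1" and k: "k \<le> n"
  defines "U \<equiv> Bernstein_tail (Suc n) (Suc k) x"
  shows "real (Suc n) * (LINT t:{0..1}|lborel. (if t < x then p else q) * Bernstein n k t)
           = p * U + q * (1 - U)"
proof -
  let ?g = "\<lambda>t. (if t < x then p else q) * Bernstein n k t"
  have bnd: "\<bar>if t < x then p else q\<bar> \<le> max \<bar>p\<bar> \<bar>q\<bar>" for t by auto
  have int: "set_integrable lborel {0..1} ?g"
    by (rule set_integrable_mult_Bernstein[OF _ bnd]) simp
  have U: "{0..1} = {0..x} \<union> {x..1}" using x by auto
  have "(LINT t:{0..1}|lborel. ?g t) = (LINT t:{0..x}|lborel. ?g t) + (LINT t:{x..1}|lborel. ?g t)"
    unfolding U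
  proof (rule set_integral_Un_AE)
    show "AE t in lborel. \<not> (t \<in> {0..x} \<and> t \<in> {x..1})"
      using AE_lborel_singleton[of x] by eventually_elim auto
  qed (use x in \<open>auto intro: set_integrable_subset[OF int]\<close>)
  also have "(LINT t:{0..x}|lborel. ?g t) = (LINT t:{0..x}|lborel. p * Bernstein n k t)"
    using AE_lborel_singleton[of x]
    by (intro set_lebesgue_integral_cong_AE) (auto elim: eventually_mono)
  also have "(LINT t:{x..1}|lborel. ?g t) = (LINT t:{x..1}|lborel. q * Bernstein n k t)"
    by (intro set_lebesgue_integral_cong) auto
  finally have "real (Suc n) * (LINT t:{0..1}|lborel. ?g t)
      = p * (real (Suc n) * (LINT t:{0..x}|lborel. Bernstein n k t))
        + q * (real (Suc n) * (LINT t:{x..1}|lborel. Bernstein n k t))"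
    by (simp add: algebra_simps)
  then show ?thesis
    using x k by (simp add: set_integral_Bernstein U_def del: of_nat_Suc)
qed

text \<open>Passes from the Lebesgue integral in the definition to the gauge integral of the Riemann
  sum lemmas; the integrand is Borel and bounded by 1.\<close>

lemma durrmeyer_nu_eq_integral:
  assumes "0 \<le> left_limit w x" "0 \<le> right_limit w x"
  shows "durrmeyer_nu w x = integral {0..1}
    (\<lambda>u. right_limit w x * (1 - u) / (left_limit w x * u + right_limit w x * (1 - u)))"
  unfolding durrmeyer_nu_def
proof (intro set_borel_integral_eq_integral set_integrable_bounded_borel[where K = 1])
  fix u :: real assume "u \<in> {0..1}"
  then show "\<bar>right_limit w x * (1 - u) / (left_limit w x * u + right_limit w x * (1 - u))\<bar> \<le> 1"
    using mixture_weight_bounds[OF assms] by (subst abs_of_nonneg)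
qed simp

text \<open>Bounded variation enters the theorem through the data assumed here: Borel measurability,
  boundedness and one-sided limits. Each quotient \<open>R n k\<close> is compared with its step
  counterpart \<open>\<tau> n k\<close>: the error is small where the step denominator is at least
  \<theta>, and it is bounded by \<open>M\<close> on the remaining indices, which carry little
  mass.\<close>

lemma tendsto_bernstein_durrmeyer:
  fixes w f :: "real \<Rightarrow> real"
  assumes x: "0 < x" "x < 1"
    and [measurable]: "w \<in> borel_measurable borel" "f \<in> borel_measurable borel"
    and w: "\<And>t. t \<in> {0..1} \<Longrightarrow> 0 \<le> w t" "\<And>t. t \<in> {0..1} \<Longrightarrow> w t \<le> W"
    and f: "\<And>t. t \<in> {0..1} \<Longrightarrow> \<bar>f t\<bar> \<le> F"
    and wl: "(w \<longlongrightarrow> a) (at_left x)" and wr: "(w \<longlongrightarrow> b) (at_right x)"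
    and fl: "(f \<longlongrightarrow> A) (at_left x)" and fr: "(f \<longlongrightarrow> B) (at_right x)"
    and ab: "0 \<le> a" "0 \<le> b" "a \<noteq> 0 \<or> b \<noteq> 0"
  defines "h \<equiv> \<lambda>u. b * (1 - u) / (a * u + b * (1 - u))"
  shows "(\<lambda>n. bernstein_durrmeyer n w f x) \<longlonglongrightarrow> A + (B - A) * integral {0..1} h"
proof -
  define U where "U n k = Bernstein_tail (Suc n) (Suc k) x" for n k
  define w0 where "w0 t = (if t < x then a else b)" for t
  define v0 where "v0 t = (if t < x then A * a else B * b)" for t
  \<comment> \<open>Shaped to match \<open>quotient_perturbation\<close>: the first summand controls
    the numerator error \<open>G\<close>, the second the term \<open>F * E\<close> from the
    denominator.\<close>
  define \<psi> where "\<psi> t = \<bar>f t * w t - v0 t\<bar> + F * \<bar>w t - w0 t\<bar>" for t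
  define I where "I n k g = real (Suc n) * (LINT t:{0..1}|lborel. g t * Bernstein n k t)"
    for n k and g :: "real \<Rightarrow> real"
  \<comment> \<open>The factor \<open>Suc n\<close> contained in \<open>I\<close> cancels, so this
    is the quotient in the operator.\<close>
  define R where "R n k = I n k (\<lambda>t. f t * w t) / I n k w" for n k
  define \<tau> where "\<tau> n k = A + (B - A) * h (U n k)" for n k
  define \<Psi> where "\<Psi> n = (\<Sum>k\<le>n. Bernstein n k x * I n k \<psi>)" for n
  have B_nonneg: "0 \<le> Bernstein n k t" if "t \<in> {0..1}" for n k t
    using that by (simp add: Bernstein_nonneg)
  have Bx: "0 \<le> Bernstein n k x" for n k using x by (intro B_nonneg) auto
  have U: "U n k \<in> {0..1}" for n k
    using Bernstein_tail_in_unit[of x "Suc n" "Suc k"] x by (simp add: U_def)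
  have [measurable]: "w0 \<in> borel_measurable borel" "v0 \<in> borel_measurable borel"
    "\<psi> \<in> borel_measurable borel"
    unfolding w0_def v0_def \<psi>_def by measurable
  have F: "0 \<le> F" using f[of 0] by simp
  have W: "0 \<le> W" using w[of 0] by simp
  have w0: "\<bar>w0 t\<bar> \<le> a + b" for t using ab by (simp add: w0_def)
  have v0: "\<bar>v0 t\<bar> \<le> \<bar>A * a\<bar> + \<bar>B * b\<bar>" for t by (simp add: v0_def)
  have fw: "\<bar>f t * w t\<bar> \<le> F * W" if "t \<in> {0..1}" for t
    using f[OF that] w[OF that] F by (auto simp: abs_mult intro!: mult_mono)
  define K where "K = F * W + (\<bar>A * a\<bar> + \<bar>B * b\<bar>) + F * (W + (a + b))"
  have d1: "\<bar>f t * w t - v0 t\<bar> \<le> F * W + (\<bar>A * a\<bar> + \<bar>B * b\<bar>)" if "t \<in> {0..1}" for t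
    using fw[OF that] v0[of t] by linarith
  have d2: "\<bar>w t - w0 t\<bar> \<le> W + (a + b)" if "t \<in> {0..1}" for t
    using w[OF that] w0[of t] by linarith
  have \<psi>_nonneg: "0 \<le> \<psi> t" for t using F by (simp add: \<psi>_def)
  have \<psi>_le: "\<psi> t \<le> K" if "t \<in> {0..1}" for t
    unfolding \<psi>_def K_def using d1[OF that] d2[OF that] F by (intro add_mono mult_left_mono)
  note int = set_integrable_mult_Bernstein
  have int_w: "set_integrable lborel {0..1} (\<lambda>t. w t * Bernstein n k t)" for n k
    using w by (intro int[where K = W]) auto
  have int_fw: "set_integrable lborel {0..1} (\<lambda>t. f t * w t * Bernstein n k t)" for n k
    using fw by (intro int) auto
  have int_w0: "set_integrable lborel {0..1} (\<lambda>t. w0 t * Bernstein n k t)" for n k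
    using w0 by (intro int) auto
  have int_v0: "set_integrable lborel {0..1} (\<lambda>t. v0 t * Bernstein n k t)" for n k
    using v0 by (intro int) auto
  have int_d1: "set_integrable lborel {0..1} (\<lambda>t. \<bar>f t * w t - v0 t\<bar> * Bernstein n k t)" for n k
    using d1 by (intro int) auto
  have int_d2: "set_integrable lborel {0..1} (\<lambda>t. \<bar>w t - w0 t\<bar> * Bernstein n k t)" for n k
    using d2 by (intro int) auto
  have I_diff: "\<bar>I n k g1 - I n k g2\<bar> \<le> I n k (\<lambda>t. \<bar>g1 t - g2 t\<bar>)"
    if g: "set_integrable lborel {0..1} (\<lambda>t. g1 t * Bernstein n k t)"
      "set_integrable lborel {0..1} (\<lambda>t. g2 t * Bernstein n k t)"
      "set_integrable lborel {0..1} (\<lambda>t. \<bar>g1 t - g2 t\<bar> * Bernstein n k t)"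
    for n k and g1 g2 :: "real \<Rightarrow> real"
  proof -
    let ?J = "\<lambda>g. LINT t:{0..1}|lborel. g t * Bernstein n k t"
    let ?d = "\<lambda>t. \<bar>g1 t - g2 t\<bar>"
    have "?J g1 \<le> (LINT t:{0..1}|lborel. g2 t * Bernstein n k t + ?d t * Bernstein n k t)"
      "?J g2 \<le> (LINT t:{0..1}|lborel. g1 t * Bernstein n k t + ?d t * Bernstein n k t)"
      unfolding distrib_right[symmetric]
      by (intro set_integral_mono g mult_right_mono B_nonneg;
          (simp only: distrib_right)?; (intro set_integral_add g)?; simp)+
    then have "?J g1 \<le> ?J g2 + ?J ?d" "?J g2 \<le> ?J g1 + ?J ?d"
      using g by (simp_all add: set_integral_add)
    then have "\<bar>?J g1 - ?J g2\<bar> \<le> ?J ?d" by linarith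
    then show ?thesis
      unfolding I_def right_diff_distrib[symmetric] abs_mult
      by (simp add: mult_left_mono del: of_nat_Suc)
  qed
  have I_\<psi>: "I n k \<psi> = I n k (\<lambda>t. \<bar>f t * w t - v0 t\<bar>) + F * I n k (\<lambda>t. \<bar>w t - w0 t\<bar>)" for n k
    using int_d1[of n k] int_d2[of n k]
    by (simp add: I_def \<psi>_def distrib_right mult.assoc set_integral_add algebra_simps)
  have I_nonneg: "0 \<le> I n k g" if "\<And>t. t \<in> {0..1} \<Longrightarrow> 0 \<le> g t" for n k g
    unfolding I_def set_lebesgue_integral_def
    by (intro mult_nonneg_nonneg integral_nonneg_AE AE_I2)
      (auto simp: indicator_def that Bernstein_nonneg)
  have I_w0: "I n k w0 = a * U n k + b * (1 - U n k)" if "k \<le> n" for n k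
    using set_integral_step_Bernstein[OF x that, of a b] by (simp add: I_def w0_def U_def)
  have I_v0: "I n k v0 = A * a * U n k + B * b * (1 - U n k)" if "k \<le> n" for n k
    using set_integral_step_Bernstein[OF x that, of "A * a" "B * b"] by (simp add: I_def v0_def U_def)
  \<comment> \<open>Besides bounding \<open>R\<close>, this forces the numerator to vanish together
    with the denominator.\<close>
  have I_fw: "\<bar>I n k (\<lambda>t. f t * w t)\<bar> \<le> F * I n k w" for n k
  proof -
    have "- (F * w t * Bernstein n k t) \<le> f t * w t * Bernstein n k t"
      "f t * w t * Bernstein n k t \<le> F * w t * Bernstein n k t" if "t \<in> {0..1}" for t
    proof -
      have "0 \<le> w t * Bernstein n k t" "- F \<le> f t" "f t \<le> F"
        using f[OF that] w(1)[OF that] B_nonneg[OF that] by (simp_all add: abs_le_iff minus_le_iff)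
      then have "- F * (w t * Bernstein n k t) \<le> f t * (w t * Bernstein n k t)"
        "f t * (w t * Bernstein n k t) \<le> F * (w t * Bernstein n k t)"
        by (blast intro: mult_right_mono)+
      then show "- (F * w t * Bernstein n k t) \<le> f t * w t * Bernstein n k t"
        "f t * w t * Bernstein n k t \<le> F * w t * Bernstein n k t" by (simp_all add: mult.assoc)
    qed
    moreover have "set_integrable lborel {0..1} (\<lambda>t. F * w t * Bernstein n k t)"
      using int_w[of n k] by (simp add: mult.assoc)
    ultimately have "- (LINT t:{0..1}|lborel. F * w t * Bernstein n k t)
        \<le> (LINT t:{0..1}|lborel. f t * w t * Bernstein n k t)"
      "(LINT t:{0..1}|lborel. f t * w t * Bernstein n k t)
        \<le> (LINT t:{0..1}|lborel. F * w t * Bernstein n k t)"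
      using int_fw[of n k]
      by (auto intro!: set_integral_mono simp: set_integral_uminus[symmetric] set_integrable_def)
    then have "\<bar>LINT t:{0..1}|lborel. f t * w t * Bernstein n k t\<bar>
        \<le> F * (LINT t:{0..1}|lborel. w t * Bernstein n k t)"
      by (simp add: abs_le_iff mult.assoc)
    then show ?thesis
      unfolding I_def abs_mult by (simp add: mult.left_commute[of F] mult_left_mono del: of_nat_Suc)
  qed
  have I_w: "0 \<le> I n k w" for n k using w by (intro I_nonneg)
  have R: "\<bar>R n k\<bar> \<le> F" for n k
    using I_fw[of n k] I_w[of n k] F by (cases "I n k w = 0") (auto simp: R_def divide_le_eq)
  have h: "0 \<le> h u" "h u \<le> 1" if "u \<in> {0..1}" for u
    using mixture_weight_bounds[OF ab(1,2) that] by (simp_all add: h_def)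
  define M where "M = F + \<bar>A\<bar> + \<bar>B - A\<bar>"
  have M: "0 \<le> M" using F by (simp add: M_def)
  have crude: "\<bar>R n k - \<tau> n k\<bar> \<le> M" for n k
  proof -
    have "\<bar>(B - A) * h (U n k)\<bar> \<le> \<bar>B - A\<bar> * 1"
      unfolding abs_mult using h[OF U[of n k]] by (intro mult_left_mono) auto
    moreover have "\<bar>r - (A + d)\<bar> \<le> \<bar>r\<bar> + \<bar>A\<bar> + \<bar>d\<bar>" for r d by linarith
    from this[of "R n k" "(B - A) * h (U n k)"]
    have "\<bar>R n k - \<tau> n k\<bar> \<le> \<bar>R n k\<bar> + \<bar>A\<bar> + \<bar>(B - A) * h (U n k)\<bar>"
      unfolding \<tau>_def .
    ultimately show ?thesis using R[of n k] unfolding M_def by linarith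
  qed
  have fine: "\<bar>R n k - \<tau> n k\<bar> \<le> I n k \<psi> / \<theta>"
    if k: "k \<le> n" and \<theta>: "0 < \<theta>" "\<theta> \<le> a * U n k + b * (1 - U n k)" for n k \<theta>
  proof -
    have D: "0 < I n k w0" using \<theta> I_w0[OF k] by simp
    \<comment> \<open>Over the common denominator,
      \<open>A * (a * U + b * (1 - U)) + (B - A) * b * (1 - U)\<close> equals
      \<open>A * a * U + B * b * (1 - U)\<close>.\<close>
    have "\<tau> n k = I n k v0 / I n k w0"
      using D unfolding \<tau>_def h_def I_v0[OF k] I_w0[OF k] by (simp add: field_simps)
    then have "\<bar>R n k - \<tau> n k\<bar> \<le> I n k \<psi> / I n k w0"
      unfolding R_def I_\<psi> using D F I_fw I_w
      by (auto intro!: quotient_perturbation I_diff int_w int_fw int_w0 int_v0 int_d1 int_d2)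
    also have "\<dots> \<le> I n k \<psi> / \<theta>"
      using \<theta> D I_w0[OF k] \<psi>_nonneg by (intro divide_left_mono I_nonneg) auto
    finally show ?thesis .
  qed
  \<comment> \<open>On each side of \<open>x\<close>, the step functions are constant and equal to
    the one-sided limits of \<open>w\<close> and of \<open>f * w\<close>.\<close>
  have "(\<psi> \<longlongrightarrow> 0) (at x)"
  proof (rule filterlim_split_at_real)
    have "((\<lambda>t. \<bar>f t * w t - A * a\<bar> + F * \<bar>w t - a\<bar>) \<longlongrightarrow> \<bar>A * a - A * a\<bar> + F * \<bar>a - a\<bar>) (at_left x)"
      by (intro tendsto_intros wl fl)
    moreover have "\<forall>\<^sub>F t in at_left x. \<bar>f t * w t - A * a\<bar> + F * \<bar>w t - a\<bar> = \<psi> t"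
      by (auto simp: eventually_at_filter \<psi>_def v0_def w0_def)
    ultimately show "(\<psi> \<longlongrightarrow> 0) (at_left x)" by (auto elim: Lim_transform_eventually)
  next
    have "((\<lambda>t. \<bar>f t * w t - B * b\<bar> + F * \<bar>w t - b\<bar>) \<longlongrightarrow> \<bar>B * b - B * b\<bar> + F * \<bar>b - b\<bar>) (at_right x)"
      by (intro tendsto_intros wr fr)
    moreover have "\<forall>\<^sub>F t in at_right x. \<bar>f t * w t - B * b\<bar> + F * \<bar>w t - b\<bar> = \<psi> t"
      by (auto simp: eventually_at_filter \<psi>_def v0_def w0_def)
    ultimately show "(\<psi> \<longlongrightarrow> 0) (at_right x)" by (auto elim: Lim_transform_eventually)
  qed
  then have \<Psi>: "\<Psi> \<longlonglongrightarrow> 0"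
    unfolding \<Psi>_def I_def using \<psi>_nonneg \<psi>_le x
    by (intro set_integral_mult_Bernstein_tendsto_0[where K = K]) auto
  have "(\<lambda>n. \<Sum>k\<le>n. Bernstein n k x * (R n k - \<tau> n k)) \<longlonglongrightarrow> 0"
  proof (rule LIMSEQ_I)
    fix r :: real assume r: "0 < r"
    \<comment> \<open>Makes \<open>M * \<epsilon>\<close> at most \<open>r / 2\<close>; the summand
      1 covers \<open>M = 0\<close>.\<close>
    define \<epsilon> where "\<epsilon> = r / (2 * (M + 1))"
    have \<epsilon>: "0 < \<epsilon>" using r M by (simp add: \<epsilon>_def)
    obtain \<theta> where \<theta>: "0 < \<theta>"
      and bad: "\<forall>\<^sub>F n in sequentially.
        (\<Sum>k\<le>n. Bernstein n k x * (if a * U n k + b * (1 - U n k) < \<theta> then 1 else 0)) < \<epsilon>"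
      using Bernstein_mass_small_mixture[OF x ab \<epsilon>] unfolding U_def by blast
    have "\<forall>\<^sub>F n in sequentially. \<Psi> n < \<theta> * r / 2"
      using \<theta> r by (intro order_tendstoD(2)[OF \<Psi>]) auto
    with bad have "\<forall>\<^sub>F n in sequentially. norm ((\<Sum>k\<le>n. Bernstein n k x * (R n k - \<tau> n k)) - 0) < r"
    proof eventually_elim
      case (elim n)
      let ?b = "\<lambda>k. if a * U n k + b * (1 - U n k) < \<theta> then 1 else 0 :: real"
      have "\<bar>\<Sum>k\<le>n. Bernstein n k x * (R n k - \<tau> n k)\<bar> \<le> (\<Sum>k\<le>n. \<bar>Bernstein n k x * (R n k - \<tau> n k)\<bar>)"
        by (rule sum_abs)
      also have "\<dots> \<le> (\<Sum>k\<le>n. Bernstein n k x * (I n k \<psi> / \<theta> + M * ?b k))"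
      proof (rule sum_mono)
        fix k assume "k \<in> {..n}"
        then have "\<bar>R n k - \<tau> n k\<bar> \<le> I n k \<psi> / \<theta> + M * ?b k"
          using crude[of n k] fine[of k n \<theta>] I_nonneg[of \<psi> n k] \<psi>_nonneg \<theta>
          by (auto intro: add_increasing simp: not_less)
        then show "\<bar>Bernstein n k x * (R n k - \<tau> n k)\<bar> \<le> Bernstein n k x * (I n k \<psi> / \<theta> + M * ?b k)"
          unfolding abs_mult using Bx[of n k] by (simp add: mult_left_mono)
      qed
      also have "\<dots> = \<Psi> n / \<theta> + M * (\<Sum>k\<le>n. Bernstein n k x * ?b k)"
        by (simp only: \<Psi>_def sum_divide_distrib sum_distrib_left sum.distrib[symmetric])
          (intro sum.cong refl, simp add: algebra_simps)
      also have "\<dots> < r / 2 + r / 2"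
      proof (rule add_less_le_mono)
        show "\<Psi> n / \<theta> < r / 2" using elim(2) \<theta> by (simp add: field_simps)
        have "M * (\<Sum>k\<le>n. Bernstein n k x * ?b k) \<le> M * \<epsilon>"
          using elim(1) M by (intro mult_left_mono) auto
        also have "\<dots> \<le> (M + 1) * \<epsilon>" using \<epsilon> by (simp add: algebra_simps)
        also have "\<dots> = r / 2" using M by (simp add: \<epsilon>_def field_simps)
        finally show "M * (\<Sum>k\<le>n. Bernstein n k x * ?b k) \<le> r / 2" .
      qed
      finally show ?case by simp
    qed
    then show "\<exists>N. \<forall>n\<ge>N. norm ((\<Sum>k\<le>n. Bernstein n k x * (R n k - \<tau> n k)) - 0) < r"
      by (simp add: eventually_sequentially)
  qed
  moreover have "(\<lambda>n. A + (B - A) * (\<Sum>k\<le>n. Bernstein n k x * h (U n k)))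
      \<longlonglongrightarrow> A + (B - A) * integral {0..1} h"
    using Bernstein_Riemann_sum_antimono[OF x antimono_on_mixture_weight[OF ab(1,2)]]
    unfolding U_def h_def by (intro tendsto_intros)
  ultimately have "(\<lambda>n. (\<Sum>k\<le>n. Bernstein n k x * (R n k - \<tau> n k))
      + (A + (B - A) * (\<Sum>k\<le>n. Bernstein n k x * h (U n k)))) \<longlonglongrightarrow> 0 + (A + (B - A) * integral {0..1} h)"
    by (rule tendsto_add)
  moreover have "(\<Sum>k\<le>n. Bernstein n k x * (R n k - \<tau> n k))
      + (A + (B - A) * (\<Sum>k\<le>n. Bernstein n k x * h (U n k))) = bernstein_durrmeyer n w f x" for n
  proof -
    \<comment> \<open>The partition of unity spreads the constant over the indices, so that all
      \<open>\<tau> n k\<close> cancel termwise.\<close>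
    have "A = (\<Sum>k\<le>n. A * Bernstein n k x)"
      unfolding sum_distrib_left[symmetric] by simp
    then have "(\<Sum>k\<le>n. Bernstein n k x * (R n k - \<tau> n k))
        + (A + (B - A) * (\<Sum>k\<le>n. Bernstein n k x * h (U n k)))
        = (\<Sum>k\<le>n. Bernstein n k x * (R n k - \<tau> n k))
        + ((\<Sum>k\<le>n. A * Bernstein n k x) + (B - A) * (\<Sum>k\<le>n. Bernstein n k x * h (U n k)))"
      by simp
    also have "\<dots> = (\<Sum>k\<le>n. Bernstein n k x * R n k)"
      unfolding sum_distrib_left sum.distrib[symmetric] \<tau>_def
      by (intro sum.cong refl) (simp add: algebra_simps)
    also have "\<dots> = bernstein_durrmeyer n w f x"
      unfolding bernstein_durrmeyer_def atMost_atLeast0 R_def I_def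
      by (intro sum.cong refl) (simp add: mult_ac del: of_nat_Suc)
    finally show ?thesis .
  qed
  ultimately show ?thesis by simp
qed

section \<open>Functions of bounded variation\<close>

text \<open>With the right end variable, the supremum of this set is the total variation function of
  \<open>f\<close>.\<close>

definition variation_sums :: "(real \<Rightarrow> real) \<Rightarrow> real \<Rightarrow> real \<Rightarrow> real set" where
  "variation_sums f a b =
     {\<Sum>i<N. \<bar>f (p (Suc i)) - f (p i)\<bar> | N p. p 0 = a \<and> p N = b \<and> (\<forall>i<N. p i < p (Suc (i::nat)))}"

text \<open>Appends \<open>t\<close> as a last partition point. Both the finiteness and the growth
  of the variation function follow from this.\<close>

lemma variation_sums_extend:
  assumes S: "S \<in> variation_sums f a s" and st: "s < t"
  shows "S + \<bar>f t - f s\<bar> \<in> variation_sums f a t"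
proof -
  obtain N p where p: "p 0 = a" "p N = s" "\<forall>i<N. p i < p (Suc i)"
    and S_eq: "S = (\<Sum>i<N. \<bar>f (p (Suc i)) - f (p i)\<bar>)"
    using S by (auto simp: variation_sums_def)
  define q where "q = p(Suc N := t)"
  have "(\<Sum>i<Suc N. \<bar>f (q (Suc i)) - f (q i)\<bar>) = S + \<bar>f t - f s\<bar>"
    using p by (simp add: S_eq q_def)
  moreover have "q 0 = a" "q (Suc N) = t" "\<forall>i<Suc N. q i < q (Suc i)"
    using p st by (auto simp: q_def less_Suc_eq)
  ultimately show ?thesis
    unfolding variation_sums_def by (intro CollectI exI[of _ "Suc N"] exI[of _ q]) simp
qed

lemma zero_in_variation_sums: "0 \<in> variation_sums f a a"
  unfolding variation_sums_def by (intro CollectI exI[of _ 0] exI[of _ "\<lambda>_. a"]) simp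

text \<open>Jordan decomposition: \<open>f = V - (V - f)\<close> with the variation function
  \<open>V\<close>.\<close>

lemma bounded_variation_on_mono_diff:
  assumes bv: "bounded_variation_on f a b" and ab: "a \<le> b"
  obtains g h where "mono_on {a..b} g" "mono_on {a..b} h" "\<And>t. t \<in> {a..b} \<Longrightarrow> f t = g t - h t"
proof -
  obtain C where C: "\<And>S. S \<in> variation_sums f a b \<Longrightarrow> S \<le> C"
    using bv unfolding bounded_variation_on_def variation_sums_def by blast
  define V where "V t = Sup (variation_sums f a t)" for t
  have ne: "variation_sums f a t \<noteq> {}" if "a \<le> t" for t
    using that zero_in_variation_sums[of f a] variation_sums_extend[of 0 f a a t] by (cases "a = t") auto
  \<comment> \<open>A partition ending before \<open>b\<close> is prolonged by one step to
    \<open>b\<close>, which can only increase its sum, so \<open>C\<close> still bounds it.\<close>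
  have bdd: "bdd_above (variation_sums f a t)" if "t \<le> b" for t
  proof (rule bdd_aboveI)
    fix S assume S: "S \<in> variation_sums f a t"
    show "S \<le> C"
    proof (cases "t = b")
      case False
      then show ?thesis using variation_sums_extend[OF S, of b] C that by fastforce
    qed (use C S in simp)
  qed
  \<comment> \<open>This one inequality makes both \<open>V\<close> and \<open>V - f\<close>
    increasing.\<close>
  have V: "\<bar>f t - f s\<bar> \<le> V t - V s" if "a \<le> s" "s < t" "t \<le> b" for s t
  proof -
    have "S \<le> V t - \<bar>f t - f s\<bar>" if "S \<in> variation_sums f a s" for S
      using cSup_upper[OF variation_sums_extend[OF that \<open>s < t\<close>] bdd[OF \<open>t \<le> b\<close>]]
      unfolding V_def by linarith
    then have "V s \<le> V t - \<bar>f t - f s\<bar>"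
      unfolding V_def using ne[OF \<open>a \<le> s\<close>] by (intro cSup_least)
    then show ?thesis by linarith
  qed
  show ?thesis
  proof
    show "mono_on {a..b} V"
      using V by (intro mono_onI) (smt (verit) atLeastAtMost_iff)
    show "mono_on {a..b} (\<lambda>t. V t - f t)"
      using V by (intro mono_onI) (smt (verit) atLeastAtMost_iff)
  qed simp
qed

section \<open>One-sided limits and Borel representatives\<close>

lemma mono_tendsto_at_left:
  fixes g :: "real \<Rightarrow> real"
  assumes "mono g"
  shows "\<exists>l. (g \<longlongrightarrow> l) (at_left x)"
proof (intro exI increasing_tendsto)
  have bdd: "bdd_above (g ` {..<x})"
    using assms by (intro bdd_aboveI[of _ "g x"]) (auto simp: mono_def)
  show "\<forall>\<^sub>F t in at_left x. g t \<le> Sup (g ` {..<x})"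
    unfolding eventually_at_filter by (intro always_eventually) (auto intro: cSup_upper bdd)
  fix y assume "y < Sup (g ` {..<x})"
  then obtain s where s: "s < x" "y < g s"
    using less_cSup_iff[OF _ bdd] by auto
  have "\<forall>\<^sub>F t in at_left x. s < t" using eventually_at_left_real[OF s(1)] by eventually_elim auto
  then show "\<forall>\<^sub>F t in at_left x. y < g t"
    by eventually_elim (meson assms less_imp_le less_le_trans monoD s(2))
qed

lemma mono_tendsto_at_right:
  fixes g :: "real \<Rightarrow> real"
  assumes "mono g"
  shows "\<exists>l. (g \<longlongrightarrow> l) (at_right x)"
proof -
  have "mono (\<lambda>t. - g (- t))" using assms by (auto simp: mono_def)
  then obtain l where "((\<lambda>t. - g (- t)) \<longlongrightarrow> l) (at_left (- x))"
    using mono_tendsto_at_left by blast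
  then have "((\<lambda>t. - g (- (- t))) \<longlongrightarrow> l) (at_right x)"
    using filterlim_at_left_to_right[of "\<lambda>t. - g (- t)" "nhds l" "- x"] by simp
  from tendsto_minus[OF this] show ?thesis by auto
qed

text \<open>The values of \<open>f\<close> outside the unit interval are arbitrary, so
  \<open>f\<close> itself may fail to be Borel measurable. The representative is a difference of
  functions monotone on the whole line, which supplies measurability, bounds and one-sided
  limits.\<close>

lemma bounded_variation_on_unit_representative:
  assumes "bounded_variation_on f 0 1" and x: "0 < x" "x < 1"
  obtains g K where "g \<in> borel_measurable borel" "\<And>t. t \<in> {0..1} \<Longrightarrow> g t = f t"
    "\<And>t. t \<in> {0..1} \<Longrightarrow> \<bar>g t\<bar> \<le> K"
    "(g \<longlongrightarrow> left_limit f x) (at_left x)" "(g \<longlongrightarrow> right_limit f x) (at_right x)"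
proof -
  obtain g1 g2 where g: "mono_on {0..1} g1" "mono_on {0..1} g2"
    and f: "\<And>t. t \<in> {0..1} \<Longrightarrow> f t = g1 t - g2 t"
    using bounded_variation_on_mono_diff[OF assms(1)] by auto
  \<comment> \<open>Clamping to the unit interval extends the monotone parts by constants.\<close>
  define c where "c t = max 0 (min 1 t)" for t :: real
  define h1 h2 where "h1 = g1 \<circ> c" and "h2 = g2 \<circ> c"
  have mono: "mono h1" "mono h2"
    using g by (auto simp: h1_def h2_def c_def mono_on_def intro!: monoI)
  have [measurable]: "h1 \<in> borel_measurable borel" "h2 \<in> borel_measurable borel"
    using mono by (auto intro: borel_measurable_mono)
  define h where "h t = h1 t - h2 t" for t
  have hf: "h t = f t" if "t \<in> {0..1}" for t
    using that by (simp add: h_def h1_def h2_def c_def f)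
  have bound: "\<bar>h t\<bar> \<le> \<bar>h1 0\<bar> + \<bar>h1 1\<bar> + \<bar>h2 0\<bar> + \<bar>h2 1\<bar>" if "t \<in> {0..1}" for t
    using that monoD[OF mono(1), of 0 t] monoD[OF mono(1), of t 1]
      monoD[OF mono(2), of 0 t] monoD[OF mono(2), of t 1] by (auto simp: h_def)
  \<comment> \<open>As \<open>x\<close> is interior, the representative and \<open>f\<close> agree
    near \<open>x\<close> and share their one-sided limits.\<close>
  have "\<forall>\<^sub>F t in nhds x. t \<in> {0<..<1}"
    using x by (intro eventually_nhds_in_open) auto
  then have eq: "\<forall>\<^sub>F t in at x within S. h t = f t" for S
    unfolding eventually_at_filter by eventually_elim (auto simp: hf)
  obtain l r where l: "(h \<longlongrightarrow> l) (at_left x)" and r: "(h \<longlongrightarrow> r) (at_right x)"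
    using mono_tendsto_at_left[OF mono(1)] mono_tendsto_at_left[OF mono(2)]
      mono_tendsto_at_right[OF mono(1)] mono_tendsto_at_right[OF mono(2)]
    unfolding h_def by (metis tendsto_diff)
  have fl: "(f \<longlongrightarrow> l) (at_left x)" "(f \<longlongrightarrow> r) (at_right x)"
    using l r eq by (auto intro: Lim_transform_eventually)
  then have "left_limit f x = l" "right_limit f x = r"
    unfolding left_limit_def right_limit_def by (auto intro!: tendsto_Lim)
  then show ?thesis
    using that[of h, OF _ hf bound] l r unfolding h_def by simp
qed

section \<open>The limit for weights and functions of bounded variation\<close>

theorem theorem1p4:
  fixes w f :: "real \<Rightarrow> real" and x :: real
  assumes "\<And>t. t \<in> {0..1} \<Longrightarrow> 0 \<le> w t"
    and "bounded_variation_on w 0 1"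
    and "0 < x" and "x < 1"
    and "left_limit w x \<noteq> 0 \<or> right_limit w x \<noteq> 0"
    and "bounded_variation_on f 0 1"
  shows "(\<lambda>n. bernstein_durrmeyer n w f x) \<longlonglongrightarrow>
           (1 - durrmeyer_nu w x) * left_limit f x + durrmeyer_nu w x * right_limit f x"
proof -
  obtain u K where u: "u \<in> borel_measurable borel" "\<And>t. t \<in> {0..1} \<Longrightarrow> u t = w t"
    "\<And>t. t \<in> {0..1} \<Longrightarrow> \<bar>u t\<bar> \<le> K"
    "(u \<longlongrightarrow> left_limit w x) (at_left x)" "(u \<longlongrightarrow> right_limit w x) (at_right x)"
    using bounded_variation_on_unit_representative[OF assms(2-4)] by metis
  obtain g F where g: "g \<in> borel_measurable borel" "\<And>t. t \<in> {0..1} \<Longrightarrow> g t = f t"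
    "\<And>t. t \<in> {0..1} \<Longrightarrow> \<bar>g t\<bar> \<le> F"
    "(g \<longlongrightarrow> left_limit f x) (at_left x)" "(g \<longlongrightarrow> right_limit f x) (at_right x)"
    using bounded_variation_on_unit_representative[OF assms(6,3,4)] by metis
  have u_nonneg: "0 \<le> u t" if "t \<in> {0..1}" for t using u(2) assms(1) that by simp
  have u_le: "u t \<le> K" if "t \<in> {0..1}" for t using u(3)[OF that] by simp
  have "\<forall>\<^sub>F t in nhds x. t \<in> {0<..<1}"
    using assms(3,4) by (intro eventually_nhds_in_open) auto
  then have ev: "\<forall>\<^sub>F t in at x within S. 0 \<le> u t" for S
    unfolding eventually_at_filter by eventually_elim (auto intro: u_nonneg)
  have lims: "0 \<le> left_limit w x" "0 \<le> right_limit w x"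
    using u(4,5) ev by (auto intro: tendsto_lowerbound)
  \<comment> \<open>All integrals run over the unit interval, so the operator does not distinguish
    \<open>w\<close> and \<open>f\<close> from their representatives.\<close>
  have "bernstein_durrmeyer n u g x = bernstein_durrmeyer n w f x" for n
    unfolding bernstein_durrmeyer_def
    by (intro sum.cong refl arg_cong2[where f = "(*)"] arg_cong2[where f = "(/)"]
        set_lebesgue_integral_cong) (auto simp: u(2) g(2))
  moreover note tendsto_bernstein_durrmeyer[OF assms(3,4) u(1) g(1) u_nonneg u_le g(3) u(4,5) g(4,5) lims assms(5)]
  ultimately show ?thesis
    by (simp add: durrmeyer_nu_eq_integral[OF lims] algebra_simps)
qed

end
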